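(* Let a hybrid linear system $\mathcal{F}$ and an integer $m\ge1$ be given, and consider any execution of the tree search algorithm on input $(\mathcal{F},m)$. If the algorithm returns vectors $(c_k)_{k=1}^m$, then the polyhedral function $V(x)=\max_{k\in[m]}c_k^\top x$ is a Lyapunov function for system $\mathcal{F}$. If the algorithm returns "No Lyapunov Found", then there is no certifying family $(c_k)_{k=1}^m$ of $m$ vectors of $\mathbb{R}^d$ for $\mathcal{F}$ (i.e., $\mathcal{F}$ admits no $m$-piece polyhedral Lyapunov function whose linear pieces form a certifying family).
   Context: Notation: $[m]=\{1,\ldots,m\}$. A hybrid linear system consists of a finite set of modes $Q$ and, for each $q\in Q$, a closed polyhedral cone $\mathcal{H}_q\subseteq\mathbb{R}^d$ and a matrix $A_q\in\mathbb{R}^{d\times d}$; it is identified with the map $\mathcal{F}(x)=\{A_qx: q\in Q,\ x\in\mathcal{H}_q\}$. A trajectory is an absolutely continuous $\xi:\mathbb{R}_{\ge0}\to\mathbb{R}^d$ with $\xi'(t)\in\mathcal{F}(\xi(t))$ for almost all $t\ge0$. A piecewise smooth function $V:\mathbb{R}^d\to\mathbb{R}$ is a Lyapunov function for $\mathcal{F}$ if it is positive everywhere except at the origin and it strictly decreases along all trajectories not starting at the origin. A family $(c_k)_{k=1}^m$ of vectors of $\mathbb{R}^d$ is called certifying for $\mathcal{F}$ if for all $x\in\mathbb{R}^d\setminus\{0\}$ and all $i\in[m]$, either there is $j\in[m]$ with $c_i^\top x<c_j^\top x$, or [$c_i^\top x>0$ and $c_i^\top v<0$ for all $v\in\mathcal{F}(x)$].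 For $Y\subseteq(\mathbb{R}^d\setminus\{0\})\times[m]\times[m]$, $S(Y)$ is the set of families $(c_k)_{k=1}^m$ with $c_k\in[-1,1]^d$ such that for every $(x,i,j)\in Y$: if $i\ne j$, then $c_i^\top x<c_j^\top x$; if $i=j$, then $c_i^\top x>0$ and $c_i^\top v<0$ for all $v\in\mathcal{F}(x)$. Tree search algorithm. It maintains a finite rooted tree; each node $u$ carries a finite set $Y(u)$ of constraints, and $S(u):=S(Y(u))$. Initially the tree is a single UNEXPLORED root with $Y(\text{root})=\emptyset$. While the tree has UNEXPLORED leaves, an iteration is performed: choose (arbitrarily) an UNEXPLORED leaf $u$. If $S(u)=\emptyset$, mark $u$ as INFEASIBLE. Otherwise choose (arbitrarily) a candidate $(c_k)_{k=1}^m\in S(u)$ and verify it as follows, with $V(x)=\max_kc_k^\top x$. (a) If there is $x$ on the boundary of $[-1,1]^d$ with $c_k^\top x\le0$ for all $k\in[m]$, pick such an $x$ and an $i\in[m]$ with $c_i^\top x=V(x)$; $(x,i)$ is the counterexample. (b) Otherwise, if for some $i\in[m]$, $q\in Q$ there is $x\in\mathcal{H}_q$ with $c_i^\top x=1\ge c_j^\top x$ for all $j\in[m]$ and $c_i^\top A_qx\ge0$, pick such $(x,i)$ as the counterexample. (c) Otherwise the verification succeeds, and the algorithm stops and returns $(c_k)_{k=1}^m$. If a counterexample $(x,i)$ was found, add $m$ children $u_1,\ldots,u_m$ to $u$, with $Y(u_j)=Y(u)\cup\{(x,i,j)\}$, all marked UNEXPLORED. If no UNEXPLORED leaf remains, the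 algorithm stops and returns "No Lyapunov Found". *)

theory Defs
  imports "HOL-Analysis.Analysis"
begin

section \<open>Hybrid linear systems and their trajectories\<close>

record ('q, 'd::finite) hybrid_system =
  modes :: "'q set"
  mode_cone :: "'q \<Rightarrow> (real^'d) set"
  mode_matrix :: "'q \<Rightarrow> real^'d^'d"

text \<open>In the library, \<^const>\<open>polyhedron\<close> already entails closedness, and the empty set
  satisfies both \<^const>\<open>polyhedron\<close> and \<^const>\<open>cone\<close>, so it has to be excluded.\<close>

definition hybrid_linear_system :: "('q, 'd::finite) hybrid_system \<Rightarrow> bool" where
  "hybrid_linear_system F \<longleftrightarrow>
     finite (modes F) \<and>
     (\<forall>q\<in>modes F. polyhedron (mode_cone F q) \<and> cone (mode_cone F q) \<and> mode_cone F q \<noteq> {})"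

definition flow :: "('q, 'd::finite) hybrid_system \<Rightarrow> real^'d \<Rightarrow> (real^'d) set" where
  "flow F x = {mode_matrix F q *v x | q. q \<in> modes F \<and> x \<in> mode_cone F q}"

text \<open>The usual epsilon-delta notion; a finite family of non-overlapping subintervals is
  represented by the set of the pairs of their endpoints.\<close>

definition abs_continuous_on_interval ::
    "real \<Rightarrow> real \<Rightarrow> (real \<Rightarrow> 'a::real_normed_vector) \<Rightarrow> bool" where
  "abs_continuous_on_interval a b f \<longleftrightarrow>
     (\<forall>\<epsilon>>0. \<exists>\<delta>>0. \<forall>D. finite D \<longrightarrow>
        (\<forall>(s, t)\<in>D. a \<le> s \<and> s \<le> t \<and> t \<le> b) \<longrightarrow>
        disjoint_family_on (\<lambda>(s, t). {s<..<t}) D \<longrightarrow>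
        (\<Sum>(s, t)\<in>D. t - s) < \<delta> \<longrightarrow>
        (\<Sum>(s, t)\<in>D. norm (f t - f s)) < \<epsilon>)"

text \<open>On the half-line, absolute continuity is understood on every compact subinterval.
  Only the values of \<open>\<xi>\<close> on \<open>{0..}\<close> matter.\<close>

definition trajectory :: "('q, 'd::finite) hybrid_system \<Rightarrow> (real \<Rightarrow> real^'d) \<Rightarrow> bool" where
  "trajectory F \<xi> \<longleftrightarrow>
     (\<forall>T\<ge>0. abs_continuous_on_interval 0 T \<xi>) \<and>
     (AE t in lebesgue_on {0..}.
        \<exists>v\<in>flow F (\<xi> t). (\<xi> has_vector_derivative v) (at t within {0..}))"

section \<open>Lyapunov functions\<close>

fun times_differentiable ::
    "nat \<Rightarrow> ('a::real_normed_vector \<Rightarrow> 'b::real_normed_vector) \<Rightarrow> bool" where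
  "times_differentiable 0 f \<longleftrightarrow> continuous_on UNIV f"
| "times_differentiable (Suc n) f \<longleftrightarrow>
     (\<forall>x. f differentiable (at x)) \<and>
     (\<forall>v. times_differentiable n (\<lambda>x. frechet_derivative f (at x) v))"

definition smooth :: "('a::real_normed_vector \<Rightarrow> 'b::real_normed_vector) \<Rightarrow> bool" where
  "smooth f \<longleftrightarrow> (\<forall>n. times_differentiable n f)"

text \<open>Finitely many closed pieces cover the space, and on each piece the function coincides
  with a smooth one. Continuity follows by pasting.\<close>

definition piecewise_smooth ::
    "('a::real_normed_vector \<Rightarrow> 'b::real_normed_vector) \<Rightarrow> bool" where
  "piecewise_smooth V \<longleftrightarrow>
     (\<exists>\<P>. finite \<P> \<and> \<Union>\<P> = UNIV \<and>
        (\<forall>P\<in>\<P>. closed P \<and> (\<exists>g. smooth g \<and> (\<forall>x\<in>P. V x = g x))))"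

definition lyapunov_function ::
    "('q, 'd::finite) hybrid_system \<Rightarrow> (real^'d \<Rightarrow> real) \<Rightarrow> bool" where
  "lyapunov_function F V \<longleftrightarrow>
     piecewise_smooth V \<and>
     (\<forall>x. 0 < V x \<longleftrightarrow> x \<noteq> 0) \<and>
     (\<forall>\<xi>. trajectory F \<xi> \<longrightarrow> \<xi> 0 \<noteq> 0 \<longrightarrow> strict_antimono_on {0..} (\<lambda>t. V (\<xi> t)))"

text \<open>A family of \<open>m\<close> vectors is a function on \<open>nat\<close> of which only the values on \<open>{1..m}\<close>
  matter.\<close>

definition max_linear :: "nat \<Rightarrow> (nat \<Rightarrow> real^'d::finite) \<Rightarrow> real^'d \<Rightarrow> real" where
  "max_linear m c x = Max ((\<lambda>k. c k \<bullet> x) ` {1..m})"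

definition certifying ::
    "('q, 'd::finite) hybrid_system \<Rightarrow> nat \<Rightarrow> (nat \<Rightarrow> real^'d) \<Rightarrow> bool" where
  "certifying F m c \<longleftrightarrow>
     (\<forall>x. x \<noteq> 0 \<longrightarrow> (\<forall>i\<in>{1..m}.
        (\<exists>j\<in>{1..m}. c i \<bullet> x < c j \<bullet> x) \<or>
        (c i \<bullet> x > 0 \<and> (\<forall>v\<in>flow F x. c i \<bullet> v < 0))))"

section \<open>The tree search algorithm\<close>

definition unit_box :: "(real^'d::finite) set" where
  "unit_box = {x. \<forall>n. x $ n \<in> {-1..1}}"

type_synonym 'd constraints = "((real^'d) \<times> nat \<times> nat) set"

definition candidates ::
    "('q, 'd::finite) hybrid_system \<Rightarrow> nat \<Rightarrow> 'd constraints \<Rightarrow> (nat \<Rightarrow> real^'d) set" where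
  "candidates F m Y =
     {c \<in> {1..m} \<rightarrow>\<^sub>E unit_box. \<forall>(x, i, j)\<in>Y.
        if i \<noteq> j then c i \<bullet> x < c j \<bullet> x
        else c i \<bullet> x > 0 \<and> (\<forall>v\<in>flow F x. c i \<bullet> v < 0)}"

definition nonpositive_point :: "nat \<Rightarrow> (nat \<Rightarrow> real^'d::finite) \<Rightarrow> real^'d \<Rightarrow> bool" where
  "nonpositive_point m c x \<longleftrightarrow> x \<in> frontier unit_box \<and> (\<forall>k\<in>{1..m}. c k \<bullet> x \<le> 0)"

definition nondecreasing_point ::
    "('q, 'd::finite) hybrid_system \<Rightarrow> nat \<Rightarrow> (nat \<Rightarrow> real^'d) \<Rightarrow> real^'d \<Rightarrow> nat \<Rightarrow> bool" where
  "nondecreasing_point F m c x i \<longleftrightarrow>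
     (\<exists>q\<in>modes F. x \<in> mode_cone F q \<and>
        c i \<bullet> x = 1 \<and> (\<forall>j\<in>{1..m}. 1 \<ge> c j \<bullet> x) \<and>
        c i \<bullet> (mode_matrix F q *v x) \<ge> 0)"

definition counterexample ::
    "('q, 'd::finite) hybrid_system \<Rightarrow> nat \<Rightarrow> (nat \<Rightarrow> real^'d) \<Rightarrow> real^'d \<Rightarrow> nat \<Rightarrow> bool" where
  "counterexample F m c x i \<longleftrightarrow> i \<in> {1..m} \<and>
     (if \<exists>y. nonpositive_point m c y
      then nonpositive_point m c x \<and> c i \<bullet> x = max_linear m c x
      else nondecreasing_point F m c x i)"

definition verified ::
    "('q, 'd::finite) hybrid_system \<Rightarrow> nat \<Rightarrow> (nat \<Rightarrow> real^'d) \<Rightarrow> bool" where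
  "verified F m c \<longleftrightarrow>
     \<not> (\<exists>x. nonpositive_point m c x) \<and>
     \<not> (\<exists>i\<in>{1..m}. \<exists>x. nondecreasing_point F m c x i)"

text \<open>A node is addressed by the list of child indices on the path from the root, so the root
  is \<open>[]\<close> and the \<open>j\<close>-th child of \<open>u\<close> is \<open>u @ [j]\<close>. The mark of a node is not touched when the
  node gets children; it then ceases to be a leaf.\<close>

datatype mark = Unexplored | Infeasible

type_synonym 'd search_tree = "nat list \<rightharpoonup> 'd constraints \<times> mark"

definition initial_tree :: "('d::finite) search_tree" where
  "initial_tree = [[] \<mapsto> ({}, Unexplored)]"

definition unexplored_leaf :: "('d::finite) search_tree \<Rightarrow> nat list \<Rightarrow> 'd constraints \<Rightarrow> bool" where
  "unexplored_leaf T u Y \<longleftrightarrow> T u = Some (Y, Unexplored) \<and> (\<forall>j. T (u @ [j]) = None)"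

definition add_children ::
    "nat \<Rightarrow> ('d::finite) search_tree \<Rightarrow> nat list \<Rightarrow> 'd constraints \<Rightarrow> real^'d \<Rightarrow> nat \<Rightarrow>
     'd search_tree" where
  "add_children m T u Y x i =
     (\<lambda>w. if \<exists>j\<in>{1..m}. w = u @ [j] then Some (insert (x, i, last w) Y, Unexplored) else T w)"

datatype ('d::finite) configuration =
    Running "'d search_tree"
  | Returned "nat \<Rightarrow> real^'d"
  | No_Lyapunov_Found

inductive search_step ::
    "('q, 'd::finite) hybrid_system \<Rightarrow> nat \<Rightarrow> 'd configuration \<Rightarrow> 'd configuration \<Rightarrow> bool"
  for F m where
  infeasible: "unexplored_leaf T u Y \<Longrightarrow> candidates F m Y = {} \<Longrightarrow>
     search_step F m (Running T) (Running (T(u \<mapsto> (Y, Infeasible))))"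
| expand: "unexplored_leaf T u Y \<Longrightarrow> c \<in> candidates F m Y \<Longrightarrow> counterexample F m c x i \<Longrightarrow>
     search_step F m (Running T) (Running (add_children m T u Y x i))"
| success: "unexplored_leaf T u Y \<Longrightarrow> c \<in> candidates F m Y \<Longrightarrow> verified F m c \<Longrightarrow>
     search_step F m (Running T) (Returned c)"
| exhausted: "\<nexists>u Y. unexplored_leaf T u Y \<Longrightarrow>
     search_step F m (Running T) No_Lyapunov_Found"

text \<open>Since the choices made by the algorithm are arbitrary, the outcomes of its executions are
  the final configurations reachable from the initial one.\<close>

definition search_outcome ::
    "('q, 'd::finite) hybrid_system \<Rightarrow> nat \<Rightarrow> 'd configuration \<Rightarrow> bool" where
  "search_outcome F m r \<longleftrightarrow>
     (search_step F m)\<^sup>*\<^sup>* (Running initial_tree) r \<and> (\<nexists>s. search_step F m r s)"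

end

theory Submission
  imports Defs
begin

text \<open>
  Soundness of a returned family. Verification succeeds exactly when \<open>V = max_linear m c\<close> is
  positive on the boundary of the box and every piece that is active on the level set \<open>V = 1\<close>
  decreases along every admissible velocity. Both \<open>V\<close> and the modes are positively homogeneous
  and the mode domains are cones, so both facts extend from there to every nonzero point
  (\<open>verified_positive\<close>, \<open>verified_active_decreasing\<close>). Along a trajectory \<open>\<xi>\<close> that stays away
  from the origin, the difference quotients of \<open>V \<circ> \<xi>\<close> are therefore eventually negative at
  almost every time (\<open>max_linear_difference_quotient_neg\<close>). What turns this into a decrease on
  whole intervals is absolute continuity: an absolutely continuous function gains nothing on a
  null set (\<open>abs_continuous_growth_bound\<close>). A trajectory that starts away from the origin does
  stay away from it, because its speed is at most a constant times its norm, so that it cannot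
  reach the origin in finite time (\<open>trajectory_avoids_origin\<close>).

  Soundness of a negative answer. Rescale a certifying family so that it lies in the box. It
  meets the constraints of the root, which has none, and whenever a leaf whose constraints it
  meets is expanded at a point \<open>x \<noteq> 0\<close>, the certifying property at \<open>x\<close> says precisely that it
  meets the new constraint of at least one child. Nor can such a leaf be marked infeasible.
  Hence there is always an unexplored leaf for that family (\<open>reachable_has_live_leaf\<close>), and the
  algorithm cannot run out of leaves.
\<close>

section \<open>Growth of absolutely continuous functions\<close>

lemma abs_continuous_on_intervalE:
  assumes "abs_continuous_on_interval a b f" "\<epsilon> > 0"
  obtains \<delta> where "\<delta> > 0"
    "\<forall>D. finite D \<longrightarrow> (\<forall>(s, t)\<in>D. a \<le> s \<and> s \<le> t \<and> t \<le> b) \<longrightarrow>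
      disjoint_family_on (\<lambda>(s, t). {s<..<t}) D \<longrightarrow> (\<Sum>(s, t)\<in>D. t - s) < \<delta> \<longrightarrow>
      (\<Sum>(s, t)\<in>D. norm (f t - f s)) < \<epsilon>"
  using assms(1)[unfolded abs_continuous_on_interval_def, rule_format, OF assms(2)] by blast

lemma abs_continuous_on_interval_mono:
  assumes "abs_continuous_on_interval a b f" "a \<le> a'" "b' \<le> b"
  shows "abs_continuous_on_interval a' b' f"
  unfolding abs_continuous_on_interval_def
proof (intro allI impI)
  fix e :: real assume "e > 0"
  obtain d where "d > 0" and *: "\<forall>D. finite D \<longrightarrow> (\<forall>(s, t)\<in>D. a \<le> s \<and> s \<le> t \<and> t \<le> b) \<longrightarrow>
      disjoint_family_on (\<lambda>(s, t). {s<..<t}) D \<longrightarrow> (\<Sum>(s, t)\<in>D. t - s) < d \<longrightarrow>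
      (\<Sum>(s, t)\<in>D. norm (f t - f s)) < e"
    using abs_continuous_on_intervalE[OF assms(1) \<open>e > 0\<close>] .
  note d = \<open>d > 0\<close> *[THEN spec, THEN mp, THEN mp, THEN mp, THEN mp]
  show "\<exists>d>0. \<forall>D. finite D \<longrightarrow> (\<forall>(s, t)\<in>D. a' \<le> s \<and> s \<le> t \<and> t \<le> b') \<longrightarrow>
        disjoint_family_on (\<lambda>(s, t). {s<..<t}) D \<longrightarrow>
        (\<Sum>(s, t)\<in>D. t - s) < d \<longrightarrow> (\<Sum>(s, t)\<in>D. norm (f t - f s)) < e"
  proof (intro exI[of _ d] conjI allI impI d)
    fix D :: "(real \<times> real) set" assume "\<forall>(s, t)\<in>D. a' \<le> s \<and> s \<le> t \<and> t \<le> b'"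
    then show "\<forall>(s, t)\<in>D. a \<le> s \<and> s \<le> t \<and> t \<le> b" using assms(2,3) by fastforce
  qed
qed

lemma abs_continuous_on_interval_lipschitz_image:
  fixes f :: "real \<Rightarrow> 'a::real_normed_vector" and g :: "'a \<Rightarrow> 'b::real_normed_vector"
  assumes ac: "abs_continuous_on_interval a b f"
    and lip: "\<And>x y. norm (g x - g y) \<le> L * norm (x - y)"
  shows "abs_continuous_on_interval a b (\<lambda>t. g (f t))"
  unfolding abs_continuous_on_interval_def
proof (intro allI impI)
  define M where "M = \<bar>L\<bar> + 1"
  have M: "M > 0" "\<And>x y. norm (g x - g y) \<le> M * norm (x - y)"
  proof -
    fix x y :: 'a
    have "L * norm (x - y) \<le> M * norm (x - y)"
      unfolding M_def by (intro mult_right_mono) auto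
    then show "norm (g x - g y) \<le> M * norm (x - y)" using lip[of x y] by linarith
  qed (simp add: M_def)
  fix e :: real assume "e > 0"
  then have "e / M > 0" using M by simp
  obtain d where "d > 0" and *: "\<forall>D. finite D \<longrightarrow> (\<forall>(s, t)\<in>D. a \<le> s \<and> s \<le> t \<and> t \<le> b) \<longrightarrow>
      disjoint_family_on (\<lambda>(s, t). {s<..<t}) D \<longrightarrow> (\<Sum>(s, t)\<in>D. t - s) < d \<longrightarrow>
      (\<Sum>(s, t)\<in>D. norm (f t - f s)) < e / M"
    using abs_continuous_on_intervalE[OF ac \<open>e / M > 0\<close>] .
  note d = \<open>d > 0\<close> *[THEN spec, THEN mp, THEN mp, THEN mp, THEN mp]
  show "\<exists>d>0. \<forall>D. finite D \<longrightarrow> (\<forall>(s, t)\<in>D. a \<le> s \<and> s \<le> t \<and> t \<le> b) \<longrightarrow>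
        disjoint_family_on (\<lambda>(s, t). {s<..<t}) D \<longrightarrow>
        (\<Sum>(s, t)\<in>D. t - s) < d \<longrightarrow> (\<Sum>(s, t)\<in>D. norm (g (f t) - g (f s))) < e"
  proof (intro exI[of _ d] conjI allI impI d(1))
    fix D :: "(real \<times> real) set"
    assume D: "finite D" "\<forall>(s, t)\<in>D. a \<le> s \<and> s \<le> t \<and> t \<le> b"
      "disjoint_family_on (\<lambda>(s, t). {s<..<t}) D" "(\<Sum>(s, t)\<in>D. t - s) < d"
    have "(\<Sum>(s, t)\<in>D. norm (g (f t) - g (f s))) \<le> (\<Sum>(s, t)\<in>D. M * norm (f t - f s))"
      using M(2) by (intro sum_mono) auto
    also have "\<dots> = M * (\<Sum>(s, t)\<in>D. norm (f t - f s))"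
      by (simp add: sum_distrib_left case_prod_beta)
    also have "\<dots> < e" using d(2)[OF D] M(1) by (simp add: pos_less_divide_eq mult.commute)
    finally show "(\<Sum>(s, t)\<in>D. norm (g (f t) - g (f s))) < e" .
  qed
qed

lemma abs_continuous_on_interval_imp_continuous_on:
  assumes "abs_continuous_on_interval a b f"
  shows "continuous_on {a..b} f"
  unfolding continuous_on_iff
proof (intro ballI allI impI)
  fix x e :: real assume x: "x \<in> {a..b}" and "e > 0"
  obtain d where "d > 0" and *: "\<forall>D. finite D \<longrightarrow> (\<forall>(s, t)\<in>D. a \<le> s \<and> s \<le> t \<and> t \<le> b) \<longrightarrow>
      disjoint_family_on (\<lambda>(s, t). {s<..<t}) D \<longrightarrow> (\<Sum>(s, t)\<in>D. t - s) < d \<longrightarrow>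
      (\<Sum>(s, t)\<in>D. norm (f t - f s)) < e"
    using abs_continuous_on_intervalE[OF assms \<open>e > 0\<close>] .
  note d = \<open>d > 0\<close> *[THEN spec, THEN mp, THEN mp, THEN mp, THEN mp]
  show "\<exists>d>0. \<forall>x'\<in>{a..b}. dist x' x < d \<longrightarrow> dist (f x') (f x) < e"
  proof (intro exI[of _ d] conjI d(1) ballI impI)
    fix y assume y: "y \<in> {a..b}" "dist y x < d"
    have "(\<Sum>(s, t)\<in>{(min x y, max x y)}. norm (f t - f s)) < e"
      using x y by (intro d(2)) (auto simp: disjoint_family_on_def dist_real_def)
    then show "dist (f y) (f x) < e"
      by (auto simp: dist_norm min_def max_def norm_minus_commute split: if_splits)
  qed
qed

text \<open>Outer regularity in the form used to make the intervals tagged in a null set short.\<close>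

lemma negligible_open_cover:
  fixes N :: "real set"
  assumes "negligible N" "e > 0"
  obtains U where "open U" "N \<subseteq> U" "U \<in> lmeasurable" "measure lebesgue U < e"
proof -
  have N: "N \<in> null_sets lebesgue" using assms(1) negligible_iff_null_sets by blast
  then obtain U where U: "open U" "N \<subseteq> U" "U - N \<in> lmeasurable"
      "emeasure lebesgue (U - N) < ennreal e"
    using sets_lebesgue_outer_open[of N e] assms(2) by blast
  have "emeasure lebesgue U = emeasure lebesgue ((U - N) \<union> N)"
    using U(2) by (simp add: Un_absorb2)
  also have "\<dots> = emeasure lebesgue (U - N)"
    using N U(3) by (intro emeasure_Un_null_set) auto
  finally have eq: "emeasure lebesgue U = emeasure lebesgue (U - N)" .
  then have "emeasure lebesgue U < ennreal e" using U(4) by simp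
  moreover have "U \<in> lmeasurable"
    using \<open>open U\<close> calculation by (intro fmeasurableI) (auto intro: less_trans)
  ultimately have "measure lebesgue U < e"
    using assms(2) by (simp add: emeasure_eq_measure2 ennreal_less_iff)
  with U \<open>U \<in> lmeasurable\<close> show ?thesis using that by blast
qed

text \<open>
  Cousin's lemma provides a tagged division of the interval that is fine with respect to the
  following gauge. At a point off the null set, the gauge is the radius within which the quotient
  bound holds, so that an interval tagged there contributes at most \<open>K\<close> times its length. At a
  point of the null set, it is an open cover of that set of small measure, so that the intervals
  tagged there have small total length and, by absolute continuity, contribute little.
  The hypothesis bounds difference quotients instead of a derivative so that the lemma applies to
  a maximum of linear functions.
\<close>

lemma abs_continuous_growth_bound:
  fixes f :: "real \<Rightarrow> real"
  assumes ac: "abs_continuous_on_interval a b f" and "a \<le> b" and "negligible N" and "0 \<le> K"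
    and quot: "\<And>t. t \<in> {a..b} - N \<Longrightarrow> \<forall>\<^sub>F s in at t within {a..b}. (f s - f t) / (s - t) \<le> K"
  shows "f b - f a \<le> K * (b - a)"
proof (rule field_le_epsilon)
  fix e :: real assume "e > 0"
  obtain d where "d > 0" and *: "\<forall>D. finite D \<longrightarrow> (\<forall>(s, t)\<in>D. a \<le> s \<and> s \<le> t \<and> t \<le> b) \<longrightarrow>
      disjoint_family_on (\<lambda>(s, t). {s<..<t}) D \<longrightarrow> (\<Sum>(s, t)\<in>D. t - s) < d \<longrightarrow>
      (\<Sum>(s, t)\<in>D. norm (f t - f s)) < e"
    using abs_continuous_on_intervalE[OF ac \<open>e > 0\<close>] .
  note d = \<open>d > 0\<close> *[THEN spec, THEN mp, THEN mp, THEN mp, THEN mp]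
  obtain U where U: "open U" "N \<subseteq> U" "U \<in> lmeasurable" "measure lebesgue U < d"
    using negligible_open_cover[OF \<open>negligible N\<close> \<open>d > 0\<close>] .
  have "\<exists>r>0. \<forall>s\<in>{a..b}. s \<noteq> t \<and> dist s t < r \<longrightarrow> (f s - f t) / (s - t) \<le> K"
    if "t \<in> {a..b} - N" for t
    using quot[OF that] by (simp add: eventually_at)
  then obtain r where r: "\<And>t. t \<in> {a..b} - N \<Longrightarrow> r t > 0"
      "\<And>t s. \<lbrakk>t \<in> {a..b} - N; s \<in> {a..b}; s \<noteq> t; dist s t < r t\<rbrakk> \<Longrightarrow> (f s - f t) / (s - t) \<le> K"
    by metis
  define \<gamma> where "\<gamma> t = (if t \<in> N then U else if t \<in> {a..b} then ball t (r t) else ball t 1)" for t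
  have "gauge \<gamma>"
    unfolding gauge_def \<gamma>_def using U r(1) by auto
  then obtain p where p: "p tagged_division_of {a..b}" "\<gamma> fine p"
    by (rule fine_division_exists_real)
  have K_interval: "\<exists>u v. k = {u..v} \<and> u \<le> x \<and> x \<le> v \<and> a \<le> u \<and> v \<le> b \<and> Inf k = u \<and> Sup k = v"
    if xk: "(x, k) \<in> p" for x k
  proof -
    obtain u v where "k = {u..v}" using tagged_division_ofD(4)[OF p(1) xk] by auto
    moreover have "x \<in> k" "k \<subseteq> {a..b}" using tagged_division_ofD(2,3)[OF p(1) xk] by auto
    ultimately show ?thesis by force
  qed
  define q where "q = {xk \<in> p. fst xk \<in> N}"
  have fin: "finite p" "finite q" using p(1) by (auto simp: q_def)
  \<comment> \<open>Absolute continuity speaks of sets of pairs of endpoints instead of tagged intervals.\<close>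
  define h where "h = (\<lambda>(x::real, k::real set). (Inf k, Sup k))"
  have disj: "{Inf k<..<Sup k} \<inter> {Inf k'<..<Sup k'} = {}"
    if xk: "(x, k) \<in> p" "(x', k') \<in> p" "(x, k) \<noteq> (x', k')" for x k x' k'
  proof -
    have "interior k \<inter> interior k' = {}" using tagged_division_ofD(5)[OF p(1) xk] .
    moreover obtain u v where "k = {u..v}" "Inf k = u" "Sup k = v"
      using K_interval[OF xk(1)] by blast
    moreover obtain u' v' where "k' = {u'..v'}" "Inf k' = u'" "Sup k' = v'"
      using K_interval[OF xk(2)] by blast
    ultimately show ?thesis by (simp add: interior_atLeastAtMost_real)
  qed
  define D where "D = h ` q"
  have "finite D" using fin by (simp add: D_def)
  have D_range: "\<forall>(s, t)\<in>D. a \<le> s \<and> s \<le> t \<and> t \<le> b"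
  proof
    fix st assume "st \<in> D"
    then obtain x k where "(x, k) \<in> p" "st = (Inf k, Sup k)" by (auto simp: D_def q_def h_def)
    with K_interval[OF this(1)] show "case st of (s, t) \<Rightarrow> a \<le> s \<and> s \<le> t \<and> t \<le> b" by auto
  qed
  have D_disj: "disjoint_family_on (\<lambda>(s, t). {s<..<t}) D"
    unfolding disjoint_family_on_def
  proof (intro ballI impI)
    fix st st' assume "st \<in> D" "st' \<in> D" and ne: "st \<noteq> st'"
    then obtain x k x' k' where xk: "(x, k) \<in> p" "(x', k') \<in> p"
      and st: "st = (Inf k, Sup k)" "st' = (Inf k', Sup k')"
      by (auto simp: D_def q_def h_def)
    then have "(x, k) \<noteq> (x', k')" using ne by auto
    from disj[OF xk this] show "(case st of (s, t) \<Rightarrow> {s<..<t}) \<inter> (case st' of (s, t) \<Rightarrow> {s<..<t}) = {}"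
      by (simp add: st)
  qed
  have D_sub: "(\<Union>(s, t)\<in>D. {s<..<t}) \<subseteq> U"
  proof -
    have "{Inf k<..<Sup k} \<subseteq> U" if "(x, k) \<in> p" "x \<in> N" for x k
      using fineD[OF p(2) that(1)] K_interval[OF that(1)] that(2) by (auto simp: \<gamma>_def)
    moreover have "\<exists>x k. (x, k) \<in> p \<and> x \<in> N \<and> y \<in> {Inf k<..<Sup k}"
      if "y \<in> (\<Union>(s, t)\<in>D. {s<..<t})" for y
      using that by (force simp: D_def q_def h_def)
    ultimately show ?thesis by blast
  qed
  have "(\<Sum>(s, t)\<in>D. t - s) = (\<Sum>(s, t)\<in>D. measure lebesgue {s<..<t})"
    using D_range by (intro sum.cong) auto
  also have "\<dots> = measure lebesgue (\<Union>(s, t)\<in>D. {s<..<t})"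
    using measure_UNION'[OF \<open>finite D\<close>, of "\<lambda>(s, t). {s<..<t}" lebesgue] D_disj
    by (auto simp: disjoint_family_on_def pairwise_def disjnt_def case_prod_beta)
  also have "\<dots> \<le> measure lebesgue U"
    using D_sub U(3) by (intro measure_mono_fmeasurable) (auto intro!: sets.finite_UN \<open>finite D\<close>)
  finally have "(\<Sum>(s, t)\<in>D. t - s) < d" using U(4) by linarith
  then have "(\<Sum>(s, t)\<in>D. norm (f t - f s)) < e"
    using d(2) \<open>finite D\<close> D_range D_disj by blast
  moreover have "(\<Sum>(s, t)\<in>D. norm (f t - f s)) = (\<Sum>(x, k)\<in>q. norm (f (Sup k) - f (Inf k)))"
  proof -
    have "(\<Sum>(s, t)\<in>h ` q. norm (f t - f s)) = sum ((\<lambda>(s, t). norm (f t - f s)) \<circ> h) q"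
    \<comment> \<open>Different tagged intervals with the same endpoints have disjoint interiors, hence are
      degenerate and contribute nothing.\<close>
    proof (rule sum.reindex_nontrivial[OF fin(2)])
      fix xk xk' assume *: "xk \<in> q" "xk' \<in> q" "xk \<noteq> xk'" "h xk = h xk'"
      obtain x k x' k' where [simp]: "xk = (x, k)" "xk' = (x', k')" by fastforce
      have "{Inf k<..<Sup k} = {}" using disj[of x k x' k'] * by (auto simp: q_def h_def)
      moreover have "Inf k \<le> Sup k" using K_interval[of x k] * by (auto simp: q_def)
      ultimately show "(case h xk of (s, t) \<Rightarrow> norm (f t - f s)) = 0" by (simp add: h_def)
    qed
    then show ?thesis unfolding D_def by (simp add: h_def comp_def case_prod_beta)
  qed
  moreover have "(\<Sum>(x, k)\<in>q. f (Sup k) - f (Inf k)) \<le> (\<Sum>(x, k)\<in>q. norm (f (Sup k) - f (Inf k)))"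
    by (intro sum_mono) (auto simp: abs_ge_self)
  ultimately have bad: "(\<Sum>(x, k)\<in>q. f (Sup k) - f (Inf k)) \<le> e"
    by linarith
  have good: "f (Sup k) - f (Inf k) \<le> K * (Sup k - Inf k)" if xk: "(x, k) \<in> p - q" for x k
  proof -
    obtain u v where k: "k = {u..v}" "u \<le> x" "x \<le> v" "a \<le> u" "v \<le> b" "Inf k = u" "Sup k = v"
      using K_interval xk by blast
    have x: "x \<in> {a..b} - N" using xk k by (auto simp: q_def)
    have "k \<subseteq> \<gamma> x" using p(2) xk by auto
    then have uv: "dist u x < r x" "dist v x < r x"
      using x k by (auto simp: \<gamma>_def dist_commute subset_iff)
    have "f v - f x \<le> K * (v - x)"
    proof (cases "v = x")
      case False
      then show ?thesis using r(2)[OF x, of v] uv k by (simp add: pos_divide_le_eq)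
    qed simp
    moreover have "f x - f u \<le> K * (x - u)"
    proof (cases "u = x")
      case False
      then have "(f x - f u) / (x - u) \<le> K"
        using r(2)[OF x, of u] uv k by (metis atLeastAtMost_iff minus_diff_eq minus_divide_divide order_trans)
      then show ?thesis using False k by (simp add: pos_divide_le_eq)
    qed simp
    ultimately show ?thesis using k by (simp add: algebra_simps)
  qed
  have len: "(\<Sum>(x, k)\<in>p. Sup k - Inf k) = b - a"
    using additive_tagged_division_1[OF \<open>a \<le> b\<close> p(1), of "\<lambda>x. x"] by simp
  have "q \<subseteq> p" by (auto simp: q_def)
  have "f b - f a = (\<Sum>(x, k)\<in>p. f (Sup k) - f (Inf k))"
    using additive_tagged_division_1[OF \<open>a \<le> b\<close> p(1), of f] by simp
  also have "\<dots> = (\<Sum>(x, k)\<in>p - q. f (Sup k) - f (Inf k)) + (\<Sum>(x, k)\<in>q. f (Sup k) - f (Inf k))"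
    by (rule sum.subset_diff[OF \<open>q \<subseteq> p\<close> fin(1)])
  also have "\<dots> \<le> (\<Sum>(x, k)\<in>p - q. K * (Sup k - Inf k)) + e"
    using bad good by (intro add_mono sum_mono) auto
  also have "(\<Sum>(x, k)\<in>p - q. K * (Sup k - Inf k)) \<le> (\<Sum>(x, k)\<in>p. K * (Sup k - Inf k))"
  proof (rule sum_mono2[OF fin(1)])
    fix xk assume "xk \<in> p - (p - q)"
    then obtain x k where "xk = (x, k)" "(x, k) \<in> p" by (cases xk) auto
    moreover from K_interval[OF this(2)] have "Inf k \<le> Sup k" by auto
    ultimately show "0 \<le> (case xk of (x, k) \<Rightarrow> K * (Sup k - Inf k))" using \<open>0 \<le> K\<close> by simp
  qed auto
  also have "\<dots> = K * (b - a)"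
    by (simp flip: len add: sum_distrib_left case_prod_beta)
  finally show "f b - f a \<le> K * (b - a) + e" by simp
qed

section \<open>Trajectories\<close>

lemma trajectory_velocity_ae:
  assumes "trajectory F \<xi>"
  obtains N where "negligible N"
    "\<forall>t\<ge>0. t \<notin> N \<longrightarrow> (\<exists>v\<in>flow F (\<xi> t). (\<xi> has_vector_derivative v) (at t within {0..}))"
proof -
  have "AE t in lebesgue. t \<in> {0..} \<longrightarrow>
      (\<exists>v\<in>flow F (\<xi> t). (\<xi> has_vector_derivative v) (at t within {0..}))"
    using assms unfolding trajectory_def by (subst (asm) AE_restrict_space_iff) auto
  then obtain N where "N \<in> null_sets lebesgue"
    "{t. \<not> (t \<in> {0..} \<longrightarrow>
      (\<exists>v\<in>flow F (\<xi> t). (\<xi> has_vector_derivative v) (at t within {0..})))} \<subseteq> N"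
    unfolding eventually_ae_filter by auto
  then show ?thesis
    by (intro that[of N]) (auto simp: negligible_iff_null_sets)
qed

lemma trajectory_abs_continuous:
  assumes "trajectory F \<xi>" "0 \<le> a" "a \<le> b"
  shows "abs_continuous_on_interval a b \<xi>"
  using assms abs_continuous_on_interval_mono[of 0 b \<xi> a b] by (auto simp: trajectory_def)

lemma flow_linear_growth:
  assumes "hybrid_linear_system F"
  obtains M where "M \<ge> 0" "\<forall>x. \<forall>v\<in>flow F x. norm v \<le> M * norm x"
proof
  let ?o = "\<lambda>q. onorm ((*v) (mode_matrix F q))"
  have fin: "finite (modes F)" using assms by (simp add: hybrid_linear_system_def)
  have nn: "?o q \<ge> 0" for q by (rule onorm_pos_le[OF matrix_vector_mul_bounded_linear])
  show "(\<Sum>q\<in>modes F. ?o q) \<ge> 0" using nn by (rule sum_nonneg)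
  show "\<forall>x. \<forall>v\<in>flow F x. norm v \<le> (\<Sum>q\<in>modes F. ?o q) * norm x"
  proof (intro allI ballI)
    fix x v assume "v \<in> flow F x"
    then obtain q where q: "q \<in> modes F" "v = mode_matrix F q *v x" by (auto simp: flow_def)
    have "norm v \<le> ?o q * norm x"
      unfolding q(2) by (rule onorm[OF matrix_vector_mul_bounded_linear])
    also have "\<dots> \<le> (\<Sum>q\<in>modes F. ?o q) * norm x"
      using member_le_sum[of q "modes F" ?o] fin nn q(1) by (intro mult_right_mono) auto
    finally show "norm v \<le> (\<Sum>q\<in>modes F. ?o q) * norm x" .
  qed
qed

lemma inner_difference_quotient_tendsto:
  fixes \<xi> :: "real \<Rightarrow> 'a::euclidean_space"
  assumes "(\<xi> has_vector_derivative v) (at t within S)"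
  shows "((\<lambda>s. (w \<bullet> \<xi> s - w \<bullet> \<xi> t) / (s - t)) \<longlongrightarrow> w \<bullet> v) (at t within S)"
proof -
  have "((\<lambda>s. w \<bullet> \<xi> s) has_vector_derivative w \<bullet> v) (at t within S)"
    by (rule bounded_linear.has_vector_derivative[OF bounded_linear_inner_right assms])
  then show ?thesis
    by (simp add: has_real_derivative_iff_has_vector_derivative[symmetric] has_field_derivative_iff)
qed

text \<open>
  A mean value inequality under a speed bound that the velocity satisfies only almost everywhere.
  It is reduced to real functions by projecting to the direction of the displacement.
\<close>

lemma trajectory_displacement_le:
  assumes traj: "trajectory F \<xi>" and ab: "0 \<le> a" "a \<le> b" and "K \<ge> 0"
    and speed: "\<And>t v. \<lbrakk>t \<in> {a..b}; v \<in> flow F (\<xi> t)\<rbrakk> \<Longrightarrow> norm v \<le> K"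
  shows "norm (\<xi> b - \<xi> a) \<le> K * (b - a)"
proof -
  obtain N where N: "negligible N"
    "\<forall>t\<ge>0. t \<notin> N \<longrightarrow> (\<exists>v\<in>flow F (\<xi> t). (\<xi> has_vector_derivative v) (at t within {0..}))"
    using trajectory_velocity_ae[OF traj] .
  define w where "w = sgn (\<xi> b - \<xi> a)"
  have w: "norm w \<le> 1" by (simp add: w_def norm_sgn)
  have ac: "abs_continuous_on_interval a b (\<lambda>t. w \<bullet> \<xi> t)"
    using trajectory_abs_continuous[OF traj ab]
  proof (rule abs_continuous_on_interval_lipschitz_image)
    show "norm (w \<bullet> x - w \<bullet> y) \<le> norm w * norm (x - y)" for x y
      by (simp add: Cauchy_Schwarz_ineq2 flip: inner_diff_right)
  qed
  \<comment> \<open>The margin \<open>e\<close> makes the bound on the derivative strict, as is required to pass from the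
    limit of the difference quotients to the quotients themselves.\<close>
  have le: "w \<bullet> \<xi> b - w \<bullet> \<xi> a \<le> (K + e) * (b - a)" if "e > 0" for e
  proof (rule abs_continuous_growth_bound[OF ac ab(2) N(1)])
    show "0 \<le> K + e" using that \<open>K \<ge> 0\<close> by simp
    fix t assume t: "t \<in> {a..b} - N"
    then have "t \<ge> 0" "t \<notin> N" using ab by auto
    then obtain v where v: "v \<in> flow F (\<xi> t)" "(\<xi> has_vector_derivative v) (at t within {0..})"
      using N(2) by blast
    have "w \<bullet> v \<le> norm w * norm v" by (rule norm_cauchy_schwarz)
    also have "\<dots> \<le> 1 * K" using w speed v t by (intro mult_mono) auto
    finally have "w \<bullet> v < K + e" using that by simp
    moreover have "((\<lambda>s. (w \<bullet> \<xi> s - w \<bullet> \<xi> t) / (s - t)) \<longlongrightarrow> w \<bullet> v) (at t within {a..b})"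
      using v(2) ab by (intro inner_difference_quotient_tendsto) (auto elim: has_vector_derivative_within_subset)
    ultimately have "\<forall>\<^sub>F s in at t within {a..b}. (w \<bullet> \<xi> s - w \<bullet> \<xi> t) / (s - t) < K + e"
      by (rule order_tendstoD(2)[rotated])
    then show "\<forall>\<^sub>F s in at t within {a..b}. (w \<bullet> \<xi> s - w \<bullet> \<xi> t) / (s - t) \<le> K + e"
      by eventually_elim simp
  qed
  have "w \<bullet> (\<xi> b - \<xi> a) = norm (\<xi> b - \<xi> a)"
    by (cases "\<xi> b = \<xi> a") (auto simp: w_def sgn_div_norm dot_square_norm power2_eq_square)
  then have "norm (\<xi> b - \<xi> a) = w \<bullet> \<xi> b - w \<bullet> \<xi> a"
    by (simp add: inner_diff_right)
  also have "\<dots> \<le> K * (b - a)"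
  proof (rule field_le_epsilon)
    fix e :: real assume "e > 0"
    then have "e / (b - a + 1) > 0" using ab by simp
    from le[OF this] have "w \<bullet> \<xi> b - w \<bullet> \<xi> a \<le> K * (b - a) + e * ((b - a) / (b - a + 1))"
      by (simp add: algebra_simps)
    also have "\<dots> \<le> K * (b - a) + e * 1"
      using ab \<open>e > 0\<close> by (intro add_left_mono mult_left_mono) (auto simp: field_simps)
    finally show "w \<bullet> \<xi> b - w \<bullet> \<xi> a \<le> K * (b - a) + e" by simp
  qed
  finally show ?thesis .
qed

text \<open>
  Suppose that \<open>z > 0\<close> is the first time at which the origin is reached. On a short interval
  that ends at \<open>z\<close>, let \<open>s\<close> be a time at which the norm is largest. Between \<open>s\<close> and \<open>z\<close> the speed
  is at most \<open>M\<close> times this largest norm, so within time \<open>1 / (2 * M)\<close> the trajectory covers at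
  most half of the way from its position at \<open>s\<close> to the origin, although it arrives there. The
  largest norm is thus zero, and the origin was reached before \<open>z\<close>.
\<close>

lemma trajectory_avoids_origin:
  assumes F: "hybrid_linear_system F" and traj: "trajectory F \<xi>" and "\<xi> 0 \<noteq> 0" and "T \<ge> 0"
  shows "\<xi> T \<noteq> 0"
proof
  assume "\<xi> T = 0"
  obtain M where M: "M \<ge> 0" "\<forall>x. \<forall>v\<in>flow F x. norm v \<le> M * norm x"
    using flow_linear_growth[OF F] .
  have cont: "continuous_on {0..T} \<xi>"
    using trajectory_abs_continuous[OF traj] \<open>T \<ge> 0\<close>
    by (intro abs_continuous_on_interval_imp_continuous_on) auto
  define Z where "Z = {t \<in> {0..T}. \<xi> t = 0}"
  have "closed Z" unfolding Z_def using cont by (intro continuous_closed_preimage_constant) auto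
  moreover have "T \<in> Z" using \<open>\<xi> T = 0\<close> \<open>T \<ge> 0\<close> by (simp add: Z_def)
  moreover have bdd: "bdd_below Z" by (auto simp: Z_def bdd_below_def)
  ultimately have "Inf Z \<in> Z" by (intro closed_contains_Inf) auto
  define z where "z = Inf Z"
  have z: "z \<in> {0..T}" "\<xi> z = 0" using \<open>Inf Z \<in> Z\<close> by (auto simp: z_def Z_def)
  then have "z > 0" using \<open>\<xi> 0 \<noteq> 0\<close> by (cases "z = 0") auto
  \<comment> \<open>The summand 1 guards against \<open>M = 0\<close>.\<close>
  define h where "h = min z (1 / (2 * (M + 1)))"
  have h: "h > 0" "h \<le> z" "M * h \<le> 1 / 2"
  proof -
    show "h > 0" "h \<le> z" using \<open>z > 0\<close> M(1) by (auto simp: h_def)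
    have "M * h \<le> M * (1 / (2 * (M + 1)))" using M(1) by (intro mult_left_mono) (auto simp: h_def)
    also have "\<dots> \<le> 1 / 2" using M(1) by (simp add: field_simps)
    finally show "M * h \<le> 1 / 2" .
  qed
  have "continuous_on {z - h..z} (\<lambda>t. norm (\<xi> t))"
    using z h by (intro continuous_intros continuous_on_subset[OF cont]) auto
  then obtain s where s: "s \<in> {z - h..z}" "\<And>t. t \<in> {z - h..z} \<Longrightarrow> norm (\<xi> t) \<le> norm (\<xi> s)"
    using continuous_attains_sup[of "{z - h..z}" "\<lambda>t. norm (\<xi> t)"] h by fastforce
  have "norm (\<xi> z - \<xi> s) \<le> (M * norm (\<xi> s)) * (z - s)"
  proof (rule trajectory_displacement_le[OF traj])
    fix t v assume "t \<in> {s..z}" "v \<in> flow F (\<xi> t)"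
    then have "norm v \<le> M * norm (\<xi> t)" "norm (\<xi> t) \<le> norm (\<xi> s)" using M(2) s by auto
    then show "norm v \<le> M * norm (\<xi> s)" using M(1) by (meson mult_left_mono order_trans)
  qed (use s z h M in auto)
  also have "\<dots> \<le> (M * norm (\<xi> s)) * h" using s M(1) by (intro mult_left_mono) auto
  also have "\<dots> = (M * h) * norm (\<xi> s)" by simp
  also have "\<dots> \<le> 1 / 2 * norm (\<xi> s)" using h(3) by (intro mult_right_mono) auto
  finally have "\<xi> s = 0" using z(2) by simp
  then have "\<xi> (z - h) = 0" using s(2)[of "z - h"] h by simp
  then have "z - h \<in> Z" using z h by (auto simp: Z_def)
  then have "z \<le> z - h" unfolding z_def using bdd by (rule cInf_lower)
  then show False using h(1) by simp
qed

section \<open>Maxima of linear functions\<close>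

lemma max_linear_ge: "k \<in> {1..m} \<Longrightarrow> c k \<bullet> x \<le> max_linear m c x"
  by (simp add: max_linear_def)

lemma max_linear_attained:
  assumes "m \<ge> 1"
  obtains k where "k \<in> {1..m}" "c k \<bullet> x = max_linear m c x"
proof -
  have "max_linear m c x \<in> (\<lambda>k. c k \<bullet> x) ` {1..m}"
    unfolding max_linear_def using assms by (intro Max_in) auto
  then show ?thesis using that by auto
qed

lemma max_linear_less_iff: "m \<ge> 1 \<Longrightarrow> max_linear m c x < r \<longleftrightarrow> (\<forall>k\<in>{1..m}. c k \<bullet> x < r)"
  by (simp add: max_linear_def)

lemma max_linear_diff_le:
  assumes "m \<ge> 1"
  shows "max_linear m c x - max_linear m c y \<le> (\<Sum>k\<in>{1..m}. norm (c k)) * norm (x - y)"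
proof -
  obtain k where k: "k \<in> {1..m}" "c k \<bullet> x = max_linear m c x"
    using max_linear_attained[OF assms] .
  have "max_linear m c x - max_linear m c y \<le> c k \<bullet> (x - y)"
    using k max_linear_ge[OF k(1), of c y] by (simp add: inner_diff_right)
  also have "\<dots> \<le> norm (c k) * norm (x - y)" by (rule norm_cauchy_schwarz)
  also have "\<dots> \<le> (\<Sum>k\<in>{1..m}. norm (c k)) * norm (x - y)"
    using k(1) by (intro mult_right_mono member_le_sum) auto
  finally show ?thesis .
qed

lemma times_differentiable_const: "times_differentiable n (\<lambda>_. c)"
  by (induction n arbitrary: c) (auto simp: frechet_derivative_const)

lemma smooth_bounded_linear:
  assumes "bounded_linear f"
  shows "smooth f"
  unfolding smooth_def
proof
  fix n
  show "times_differentiable n f"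
  proof (cases n)
    case 0
    then show ?thesis using assms by (simp add: linear_continuous_on)
  next
    case (Suc k)
    have "frechet_derivative f (at x) = f" for x
      using bounded_linear_imp_has_derivative[OF assms] by (rule frechet_derivative_at[symmetric])
    then show ?thesis
      using Suc bounded_linear_imp_differentiable[OF assms] by (simp add: times_differentiable_const)
  qed
qed

text \<open>The pieces are the polyhedral cones on which a fixed one of the linear functions is largest.\<close>

lemma piecewise_smooth_max_linear:
  assumes "m \<ge> 1"
  shows "piecewise_smooth (max_linear m c)"
proof -
  define P where "P k = {x. \<forall>j\<in>{1..m}. c j \<bullet> x \<le> c k \<bullet> x}" for k
  show ?thesis
    unfolding piecewise_smooth_def
  proof (intro exI[of _ "P ` {1..m}"] conjI ballI)
    show "\<Union> (P ` {1..m}) = UNIV"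
    proof -
      have "\<exists>k\<in>{1..m}. x \<in> P k" for x
      proof -
        obtain k where k: "k \<in> {1..m}" "c k \<bullet> x = max_linear m c x"
          using max_linear_attained[OF assms] .
        then have "x \<in> P k" using max_linear_ge[of _ m c x] by (simp add: P_def)
        with k(1) show ?thesis by blast
      qed
      then show ?thesis by blast
    qed
    fix Q assume "Q \<in> P ` {1..m}"
    then obtain k where k: "k \<in> {1..m}" "Q = P k" by blast
    have "Q = (\<Inter>j\<in>{1..m}. {x. c j \<bullet> x \<le> c k \<bullet> x})" by (auto simp: k(2) P_def)
    then show "closed Q"
      by (auto intro!: closed_INT closed_Collect_le continuous_intros)
    have "max_linear m c x = c k \<bullet> x" if "x \<in> Q" for x
    proof (rule antisym)
      obtain j where "j \<in> {1..m}" "c j \<bullet> x = max_linear m c x"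
        using max_linear_attained[OF assms] .
      then show "max_linear m c x \<le> c k \<bullet> x" using that k(2) unfolding P_def by force
    qed (rule max_linear_ge[OF k(1)])
    then show "\<exists>g. smooth g \<and> (\<forall>x\<in>Q. max_linear m c x = g x)"
      by (intro exI[of _ "\<lambda>x. c k \<bullet> x"]) (simp add: smooth_bounded_linear bounded_linear_inner_right)
  qed simp
qed

section \<open>Verified families\<close>

lemma unit_box_eq_cbox: "unit_box = cbox (- 1) (1 :: real^'d::finite)"
  by (auto simp: unit_box_def mem_box_cart)

lemma zero_in_interior_unit_box: "0 \<in> interior (unit_box :: (real^'d::finite) set)"
  by (simp add: unit_box_eq_cbox interior_cbox mem_box_cart)

text \<open>Every ray from the origin meets the boundary of the box, where positivity was checked.\<close>

lemma verified_positive: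
  fixes x :: "real^'d::finite"
  assumes "m \<ge> 1" "verified F m c" "x \<noteq> 0"
  shows "max_linear m c x > 0"
proof -
  obtain r where r: "r > 0" "0 + r *\<^sub>R x \<in> frontier unit_box"
    using ray_to_frontier[OF _ zero_in_interior_unit_box \<open>x \<noteq> 0\<close>]
    by (metis bounded_cbox unit_box_eq_cbox)
  then obtain k where k: "k \<in> {1..m}" "c k \<bullet> (r *\<^sub>R x) > 0"
    using assms(2) by (force simp: verified_def nonpositive_point_def not_le)
  then have "c k \<bullet> x > 0" using r(1) by (simp add: zero_less_mult_iff)
  then show ?thesis using max_linear_ge[OF k(1), of c x] by simp
qed

text \<open>
  Scaling \<open>x\<close> to the level set where the maximum is 1 keeps it in the cone of its mode and keeps
  the sign of \<open>c i \<bullet> v\<close>, so a violation at \<open>x\<close> would have been found by the verification.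
\<close>

lemma verified_active_decreasing:
  assumes F: "hybrid_linear_system F" and "m \<ge> 1" "verified F m c" "x \<noteq> 0"
    and i: "i \<in> {1..m}" "c i \<bullet> x = max_linear m c x" and "v \<in> flow F x"
  shows "c i \<bullet> v < 0"
proof (rule ccontr)
  assume "\<not> c i \<bullet> v < 0"
  obtain q where q: "q \<in> modes F" "x \<in> mode_cone F q" "v = mode_matrix F q *v x"
    using \<open>v \<in> flow F x\<close> by (auto simp: flow_def)
  define V where "V = max_linear m c x"
  have V: "V > 0" unfolding V_def using verified_positive assms by blast
  have "nondecreasing_point F m c (inverse V *\<^sub>R x) i"
    unfolding nondecreasing_point_def
  proof (intro bexI[OF _ q(1)] conjI ballI)
    have "cone (mode_cone F q)" using F q(1) by (simp add: hybrid_linear_system_def)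
    then show "inverse V *\<^sub>R x \<in> mode_cone F q"
      using q(2) V by (simp add: mem_cone)
    show "c i \<bullet> (inverse V *\<^sub>R x) = 1" using i(2) V by (simp add: V_def)
    show "1 \<ge> c j \<bullet> (inverse V *\<^sub>R x)" if "j \<in> {1..m}" for j
      using max_linear_ge[OF that, of c x] V by (simp add: V_def field_simps)
    show "c i \<bullet> (mode_matrix F q *v (inverse V *\<^sub>R x)) \<ge> 0"
      using \<open>\<not> c i \<bullet> v < 0\<close> V by (simp add: q(3) matrix_vector_mult_scaleR)
  qed
  then show False using assms(3) i(1) by (auto simp: verified_def)
qed

text \<open>
  The maximum need not be differentiable along \<open>\<xi>\<close>, but its quotients have a sign on either side
  of \<open>t\<close>. After \<open>t\<close>, the active pieces have dropped below the value at \<open>t\<close> and the others are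
  still below it by continuity. Before \<open>t\<close>, a single piece \<open>k\<close> active at \<open>t\<close>
  suffices: it lies above its value at \<open>t\<close> and lifts the maximum with it.
\<close>

lemma max_linear_difference_quotient_neg:
  fixes \<xi> :: "real \<Rightarrow> real^'d::finite"
  assumes "m \<ge> 1" and deriv: "(\<xi> has_vector_derivative v) (at t within S)"
    and active: "\<And>i. \<lbrakk>i \<in> {1..m}; c i \<bullet> \<xi> t = max_linear m c (\<xi> t)\<rbrakk> \<Longrightarrow> c i \<bullet> v < 0"
  shows "\<forall>\<^sub>F s in at t within S. (max_linear m c (\<xi> s) - max_linear m c (\<xi> t)) / (s - t) < 0"
proof -
  let ?V = "\<lambda>s. max_linear m c (\<xi> s)"
  obtain k where k: "k \<in> {1..m}" "c k \<bullet> \<xi> t = ?V t"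
    using max_linear_attained[OF \<open>m \<ge> 1\<close>] .
  have slope: "\<forall>\<^sub>F s in at t within S. (c i \<bullet> \<xi> s - ?V t) / (s - t) < 0"
    if "i \<in> {1..m}" "c i \<bullet> \<xi> t = ?V t" for i
    using order_tendstoD(2)[OF inner_difference_quotient_tendsto[OF deriv, of "c i"] active[OF that]] that(2)
    by simp
  have below: "\<forall>\<^sub>F s in at t within S. t < s \<longrightarrow> c i \<bullet> \<xi> s < ?V t" if i: "i \<in> {1..m}" for i
  proof (cases "c i \<bullet> \<xi> t = ?V t")
    case True
    show ?thesis using slope[OF i True] by eventually_elim (auto simp: divide_less_0_iff)
  next
    case False
    then have "c i \<bullet> \<xi> t < ?V t" using max_linear_ge[OF i, of c "\<xi> t"] by simp
    moreover have "((\<lambda>s. c i \<bullet> \<xi> s) \<longlongrightarrow> c i \<bullet> \<xi> t) (at t within S)"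
      using has_vector_derivative_continuous[OF deriv]
      by (intro tendsto_inner tendsto_const) (simp add: continuous_within)
    ultimately have "\<forall>\<^sub>F s in at t within S. c i \<bullet> \<xi> s < ?V t" by (rule order_tendstoD(2)[rotated])
    then show ?thesis by eventually_elim simp
  qed
  have "\<forall>\<^sub>F s in at t within S. \<forall>i\<in>{1..m}. t < s \<longrightarrow> c i \<bullet> \<xi> s < ?V t"
    using below by (intro eventually_ball_finite) auto
  moreover have "\<forall>\<^sub>F s in at t within S. s \<noteq> t"
    by (simp add: eventually_at_filter)
  ultimately show ?thesis
    using slope[OF k]
  proof eventually_elim
    case (elim s)
    show ?case
    proof (cases "t < s")
      case True
      then have "?V s < ?V t" using elim \<open>m \<ge> 1\<close> by (simp add: max_linear_less_iff)
      then show ?thesis using True by (simp add: divide_less_0_iff)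
    next
      case False
      then have "s < t" using elim by simp
      then have "c k \<bullet> \<xi> s > ?V t" using elim by (simp add: divide_less_0_iff)
      then have "?V s > ?V t" using max_linear_ge[OF k(1), of c "\<xi> s"] by simp
      then show ?thesis using \<open>s < t\<close> by (simp add: divide_less_0_iff)
    qed
  qed
qed

text \<open>
  The growth bound with \<open>K = 0\<close> yields a weak decrease. If it were not strict, the function would
  be constant on some interval, which contains a time off the null set; there the difference
  quotients are negative instead of zero.
\<close>

lemma verified_decreases_along_trajectories:
  assumes F: "hybrid_linear_system F" and "m \<ge> 1" and ver: "verified F m c"
    and traj: "trajectory F \<xi>" and "\<xi> 0 \<noteq> 0"
  shows "strict_antimono_on {0..} (\<lambda>t. max_linear m c (\<xi> t))"
proof -
  let ?V = "\<lambda>t. max_linear m c (\<xi> t)"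
  obtain N where N: "negligible N"
    "\<forall>t\<ge>0. t \<notin> N \<longrightarrow> (\<exists>v\<in>flow F (\<xi> t). (\<xi> has_vector_derivative v) (at t within {0..}))"
    using trajectory_velocity_ae[OF traj] .
  have quot: "\<forall>\<^sub>F s in at t within {0..}. (?V s - ?V t) / (s - t) < 0" if t: "t \<ge> 0" "t \<notin> N" for t
  proof -
    obtain v where v: "v \<in> flow F (\<xi> t)" "(\<xi> has_vector_derivative v) (at t within {0..})"
      using N(2) t by blast
    show ?thesis
    proof (rule max_linear_difference_quotient_neg[OF \<open>m \<ge> 1\<close> v(2)])
      have "\<xi> t \<noteq> 0" using trajectory_avoids_origin[OF F traj \<open>\<xi> 0 \<noteq> 0\<close> t(1)] .
      then show "c i \<bullet> v < 0" if "i \<in> {1..m}" "c i \<bullet> \<xi> t = ?V t" for i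
        using verified_active_decreasing[OF F \<open>m \<ge> 1\<close> ver _ that v(1)] by blast
    qed
  qed
  have mono: "?V b \<le> ?V a" if ab: "0 \<le> a" "a \<le> b" for a b
  proof -
    have "?V b - ?V a \<le> 0 * (b - a)"
    proof (rule abs_continuous_growth_bound[OF _ ab(2) N(1)])
      show "abs_continuous_on_interval a b ?V"
        using trajectory_abs_continuous[OF traj ab]
      proof (rule abs_continuous_on_interval_lipschitz_image)
        show "norm (max_linear m c x - max_linear m c y) \<le> (\<Sum>k\<in>{1..m}. norm (c k)) * norm (x - y)" for x y
          using max_linear_diff_le[OF \<open>m \<ge> 1\<close>, of c x y] max_linear_diff_le[OF \<open>m \<ge> 1\<close>, of c y x]
          by (simp add: norm_minus_commute abs_le_iff)
      qed
      fix t assume "t \<in> {a..b} - N"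
      then have "\<forall>\<^sub>F s in at t within {0..}. (?V s - ?V t) / (s - t) < 0" using quot ab by auto
      moreover have "at t within {a..b} \<le> at t within {0..}" using ab by (intro at_le) auto
      ultimately have "\<forall>\<^sub>F s in at t within {a..b}. (?V s - ?V t) / (s - t) < 0"
        using filter_leD by blast
      then show "\<forall>\<^sub>F s in at t within {a..b}. (?V s - ?V t) / (s - t) \<le> 0"
        by eventually_elim simp
    qed simp
    then show ?thesis by simp
  qed
  show ?thesis
  proof (rule monotone_onI)
    fix a b :: real assume ab: "a \<in> {0..}" "b \<in> {0..}" "a < b"
    show "?V a > ?V b"
    proof (rule ccontr)
      assume "\<not> ?V a > ?V b"
      then have const: "?V s = ?V a" if "s \<in> {a..b}" for s
        using mono[of a s] mono[of s b] that ab by auto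
      have "\<not> negligible {a<..<b}" using ab negligible_interval(2)[of a b] by simp
      then obtain t where t: "t \<in> {a<..<b}" "t \<notin> N"
        using N(1) negligible_subset by blast
      have "at t within {0..} = at t" using t(1) ab by (intro at_within_interior) auto
      then have "\<forall>\<^sub>F s in at t. (?V s - ?V t) / (s - t) < 0" using quot[of t] t ab by simp
      moreover have "\<forall>\<^sub>F s in at t. s \<in> {a<..<b}"
        using t(1) by (intro eventually_at_in_open') auto
      ultimately have "\<forall>\<^sub>F s in at t. False"
      proof eventually_elim
        case (elim s)
        then show ?case using const[of s] const[of t] t(1) by simp
      qed
      then show False by simp
    qed
  qed
qed

lemma verified_imp_lyapunov_function:
  assumes F: "hybrid_linear_system F" and "m \<ge> 1" and "verified F m c"
  shows "lyapunov_function F (max_linear m c)"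
  unfolding lyapunov_function_def
proof (intro conjI allI impI)
  fix x :: "real^'b"
  have "max_linear m c 0 = 0" using \<open>m \<ge> 1\<close> by (simp add: max_linear_def)
  then show "0 < max_linear m c x \<longleftrightarrow> x \<noteq> 0" using verified_positive assms by fastforce
qed (use assms piecewise_smooth_max_linear verified_decreases_along_trajectories in auto)

section \<open>The search tree\<close>

lemma candidates_insert:
  "c \<in> candidates F m (insert (x, i, j) Y) \<longleftrightarrow> c \<in> candidates F m Y \<and>
     (if i \<noteq> j then c i \<bullet> x < c j \<bullet> x else c i \<bullet> x > 0 \<and> (\<forall>v\<in>flow F x. c i \<bullet> v < 0))"
  by (auto simp: candidates_def)

text \<open>
  The two alternatives of the certifying property at \<open>x\<close> match the two kinds of children: some
  \<open>j\<close> with a larger value gives a child \<open>j \<noteq> i\<close>, and otherwise the child \<open>j = i\<close> qualifies.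
\<close>

lemma certifying_satisfies_some_child:
  assumes "certifying F m c" "x \<noteq> 0" "i \<in> {1..m}" "c \<in> candidates F m Y"
  obtains j where "j \<in> {1..m}" "c \<in> candidates F m (insert (x, i, j) Y)"
proof (cases "\<exists>j\<in>{1..m}. c i \<bullet> x < c j \<bullet> x")
  case True
  then obtain j where "j \<in> {1..m}" "c i \<bullet> x < c j \<bullet> x" by blast
  moreover from this have "i \<noteq> j" by auto
  ultimately show ?thesis using that[of j] assms(4) by (simp add: candidates_insert)
next
  case False
  then have "c i \<bullet> x > 0 \<and> (\<forall>v\<in>flow F x. c i \<bullet> v < 0)"
    using assms(1-3) unfolding certifying_def by blast
  then show ?thesis using that[of i] assms(3,4) by (simp add: candidates_insert)
qed

text \<open>
  The certifying property is invariant under scaling by a positive number, so a family can be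
  shrunk into the box. Candidates are extensional functions, whence the restriction to \<open>{1..m}\<close>.
\<close>

lemma certifying_normalised:
  assumes "certifying F m c"
  obtains c' where "certifying F m c'" "c' \<in> candidates F m {}"
proof -
  define r where "r = 1 / (1 + (\<Sum>k\<in>{1..m}. norm (c k)))"
  define c' where "c' = (\<lambda>k\<in>{1..m}. r *\<^sub>R c k)"
  have pos: "1 + (\<Sum>k\<in>{1..m}. norm (c k)) > 0"
    by (smt (verit) norm_ge_zero sum_nonneg)
  then have "r > 0" by (simp add: r_def)
  have "certifying F m c'"
    unfolding certifying_def
  proof (intro allI impI ballI)
    fix x i assume x: "x \<noteq> (0 :: real^'b)" and i: "i \<in> {1..m}"
    have c': "c' k \<bullet> y = r * (c k \<bullet> y)" if "k \<in> {1..m}" for k y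
      using that by (simp add: c'_def)
    from x i assms have "(\<exists>j\<in>{1..m}. c i \<bullet> x < c j \<bullet> x) \<or>
        (c i \<bullet> x > 0 \<and> (\<forall>v\<in>flow F x. c i \<bullet> v < 0))"
      unfolding certifying_def by blast
    then show "(\<exists>j\<in>{1..m}. c' i \<bullet> x < c' j \<bullet> x) \<or>
        (c' i \<bullet> x > 0 \<and> (\<forall>v\<in>flow F x. c' i \<bullet> v < 0))"
    proof
      assume "\<exists>j\<in>{1..m}. c i \<bullet> x < c j \<bullet> x"
      then obtain j where "j \<in> {1..m}" "c i \<bullet> x < c j \<bullet> x" by blast
      then have "c' i \<bullet> x < c' j \<bullet> x" using c' i \<open>r > 0\<close> by simp
      with \<open>j \<in> {1..m}\<close> show ?thesis by blast
    next
      assume "c i \<bullet> x > 0 \<and> (\<forall>v\<in>flow F x. c i \<bullet> v < 0)"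
      then show ?thesis using c'[OF i] \<open>r > 0\<close> by (simp add: mult_pos_neg)
    qed
  qed
  moreover have "r *\<^sub>R c k \<in> unit_box" if k: "k \<in> {1..m}" for k
  proof -
    have "norm (c k) \<le> (\<Sum>k\<in>{1..m}. norm (c k))" using k by (intro member_le_sum) auto
    then have "r * norm (c k) \<le> 1" using pos by (simp add: r_def)
    then have "norm (r *\<^sub>R c k) \<le> 1" using \<open>r > 0\<close> by simp
    then have "\<bar>(r *\<^sub>R c k) $ n\<bar> \<le> 1" for n using component_le_norm_cart order_trans by blast
    then show ?thesis unfolding unit_box_def by (simp only: mem_Collect_eq atLeastAtMost_iff abs_le_iff) force
  qed
  then have "c' \<in> candidates F m {}" by (auto simp: candidates_def c'_def)
  ultimately show ?thesis using that by blast
qed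

lemma counterexample_nonzero: "counterexample F m c x i \<Longrightarrow> x \<noteq> 0"
  using zero_in_interior_unit_box
  by (auto simp: counterexample_def nonpositive_point_def nondecreasing_point_def frontier_def
      split: if_splits)

text \<open>
  This guarantees that a freshly added child has no children itself, hence is a leaf.
\<close>

definition prefix_closed :: "('d::finite) search_tree \<Rightarrow> bool" where
  "prefix_closed T \<longleftrightarrow> (\<forall>u j. T u = None \<longrightarrow> T (u @ [j]) = None)"

definition has_live_leaf ::
    "('q, 'd::finite) hybrid_system \<Rightarrow> nat \<Rightarrow> (nat \<Rightarrow> real^'d) \<Rightarrow> 'd search_tree \<Rightarrow> bool" where
  "has_live_leaf F m c T \<longleftrightarrow> (\<exists>u Y. unexplored_leaf T u Y \<and> c \<in> candidates F m Y)"

lemma prefix_closed_add_children: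
  assumes "prefix_closed T" "T u \<noteq> None"
  shows "prefix_closed (add_children m T u Y x i)"
  using assms by (auto simp: prefix_closed_def add_children_def)

lemma has_live_leaf_mark_infeasible:
  assumes "has_live_leaf F m c T" "unexplored_leaf T u Y" "candidates F m Y = {}"
  shows "has_live_leaf F m c (T(u \<mapsto> (Y, Infeasible)))"
proof -
  obtain w Z where w: "unexplored_leaf T w Z" "c \<in> candidates F m Z"
    using assms(1) by (auto simp: has_live_leaf_def)
  then have "w \<noteq> u" using assms(2,3) by (auto simp: unexplored_leaf_def)
  then have "unexplored_leaf (T(u \<mapsto> (Y, Infeasible))) w Z"
    using w(1) assms(2) by (auto simp: unexplored_leaf_def)
  with w(2) show ?thesis by (auto simp: has_live_leaf_def)
qed

text \<open>
  If the expanded leaf is the live one, a suitable child takes over. A different live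
  leaf is untouched, because every new node is a child of \<open>u\<close>, which had none.
\<close>

lemma has_live_leaf_add_children:
  assumes "has_live_leaf F m c T" "prefix_closed T" "unexplored_leaf T u Y"
    and cert: "certifying F m c" "x \<noteq> 0" "i \<in> {1..m}"
  shows "has_live_leaf F m c (add_children m T u Y x i)"
proof -
  obtain w Z where w: "unexplored_leaf T w Z" "c \<in> candidates F m Z"
    using assms(1) by (auto simp: has_live_leaf_def)
  show ?thesis
  proof (cases "w = u")
    case True
    then have "c \<in> candidates F m Y" using w assms(3) by (auto simp: unexplored_leaf_def)
    then obtain j where j: "j \<in> {1..m}" "c \<in> candidates F m (insert (x, i, j) Y)"
      using certifying_satisfies_some_child[OF cert] by blast
    have "T (u @ [j]) = None" using assms(3) by (simp add: unexplored_leaf_def)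
    then have "T ((u @ [j]) @ [k]) = None" for k using assms(2) unfolding prefix_closed_def by blast
    then have "unexplored_leaf (add_children m T u Y x i) (u @ [j]) (insert (x, i, j) Y)"
      using j(1) by (simp add: unexplored_leaf_def add_children_def)
    with j(2) show ?thesis by (auto simp: has_live_leaf_def)
  next
    case False
    have "w \<noteq> u @ [j]" for j using w(1) assms(3) by (auto simp: unexplored_leaf_def)
    then have "unexplored_leaf (add_children m T u Y x i) w Z"
      using False w(1) by (auto simp: unexplored_leaf_def add_children_def)
    with w(2) show ?thesis by (auto simp: has_live_leaf_def)
  qed
qed

lemma reachable_has_live_leaf:
  assumes cert: "certifying F m c" "c \<in> candidates F m {}"
    and "(search_step F m)\<^sup>*\<^sup>* (Running initial_tree) r"
  shows "(\<forall>T. r = Running T \<longrightarrow> prefix_closed T \<and> has_live_leaf F m c T) \<and> r \<noteq> No_Lyapunov_Found"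
  using assms(3)
proof (induction rule: rtranclp_induct)
  case base
  have "unexplored_leaf initial_tree [] {}" by (simp add: unexplored_leaf_def initial_tree_def)
  moreover have "prefix_closed initial_tree" by (simp add: prefix_closed_def initial_tree_def)
  ultimately show ?case using cert(2) by (auto simp: has_live_leaf_def)
next
  case (step r s)
  from step(2) show ?case
  proof cases
    case (infeasible T u Y)
    have "prefix_closed (T(u \<mapsto> (Y, Infeasible)))"
      using step.IH infeasible by (auto simp: prefix_closed_def unexplored_leaf_def)
    then show ?thesis using has_live_leaf_mark_infeasible step.IH infeasible by auto
  next
    case (expand T u Y c' x i)
    have "x \<noteq> 0" "i \<in> {1..m}"
      using counterexample_nonzero[OF expand(5)] expand(5) unfolding counterexample_def by blast+
    then show ?thesis
      using has_live_leaf_add_children[OF _ _ expand(3) cert(1)] prefix_closed_add_children[of T u]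
        step.IH expand by (auto simp: unexplored_leaf_def)
  next
    case (exhausted T)
    then show ?thesis using step.IH by (auto simp: has_live_leaf_def)
  qed simp
qed

lemma returned_verified:
  assumes "(search_step F m)\<^sup>*\<^sup>* (Running initial_tree) (Returned c)"
  shows "verified F m c"
  using assms by (cases rule: rtranclp.cases) (auto elim: search_step.cases)

theorem corollary5:
  fixes F :: "('q, 'd::finite) hybrid_system" and m :: nat
  assumes "hybrid_linear_system F" and "m \<ge> 1"
  shows "(\<forall>c. search_outcome F m (Returned c) \<longrightarrow> lyapunov_function F (max_linear m c)) \<and>
         (search_outcome F m No_Lyapunov_Found \<longrightarrow>
            (\<nexists>c :: nat \<Rightarrow> real^'d. certifying F m c))"
proof (intro conjI allI impI notI)
  fix c assume "search_outcome F m (Returned c)"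
  then show "lyapunov_function F (max_linear m c)"
    using verified_imp_lyapunov_function[OF assms] returned_verified
    unfolding search_outcome_def by blast
next
  assume outcome: "search_outcome F m No_Lyapunov_Found"
    and "\<exists>c :: nat \<Rightarrow> real^'d. certifying F m c"
  then obtain c :: "nat \<Rightarrow> real^'d" where "certifying F m c" "c \<in> candidates F m {}"
    using certifying_normalised by metis
  from reachable_has_live_leaf[OF this] outcome show False
    unfolding search_outcome_def by blast
qed

end
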